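(* For any fixed integer $r\geq 2$, $$D(n,r) = \Omega\left( \left(\frac{n}{\ln(n)}\right)^{\frac{r-1}{r}} r^n\right)\qquad\text{as } n\to\infty.$$ That is, for every integer $r\ge 2$ there exist a constant $C=C(r)>0$ and an integer $n_0=n_0(r)$ such that $D(n,r)\geq C\left(\frac{n}{\ln(n)}\right)^{\frac{r-1}{r}} r^n$ for all integers $n\ge n_0$.
   Context: A (finite) hypergraph is a pair $(V,E)$, where $V$ is a finite set of vertices and $E$ is a family (set) of subsets of $V$, called edges. It is $n$-uniform if all its edges have exactly $n$ elements. It is $r$-colorable if there exists a function $c:V\to\{1,\ldots,r\}$ such that no edge is monochromatic, i.e. the image under $c$ of every edge has at least two elements. The degree of an edge $f\in E$ is the number of edges $e\in E$, $e\neq f$, with $e\cap f\neq\emptyset$. $D(n,r)$ denotes the maximum number such that every $n$-uniform hypergraph in which all edge degrees are strictly smaller than $D(n,r)$ is $r$-colorable. The asymptotics are for fixed $r$ and $n$ tending to infinity. *)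

theory Defs
  imports Complex_Main "HOL-Library.Landau_Symbols"
begin

type_synonym 'a hypergraph = "'a set \<times> 'a set set"

definition hypergraph :: "'a hypergraph \<Rightarrow> bool" where
  "hypergraph H \<longleftrightarrow> finite (fst H) \<and> (\<forall>e\<in>snd H. e \<subseteq> fst H)"

definition uniform :: "nat \<Rightarrow> 'a hypergraph \<Rightarrow> bool" where
  "uniform n H \<longleftrightarrow> (\<forall>e\<in>snd H. card e = n)"

definition colorable :: "nat \<Rightarrow> 'a hypergraph \<Rightarrow> bool" where
  "colorable r H \<longleftrightarrow> (\<exists>c :: 'a \<Rightarrow> nat. c ` fst H \<subseteq> {1..r} \<and> (\<forall>e\<in>snd H. 2 \<le> card (c ` e)))"

definition edge_degree :: "'a hypergraph \<Rightarrow> 'a set \<Rightarrow> nat" where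
  "edge_degree H f = card {e \<in> snd H. e \<noteq> f \<and> e \<inter> f \<noteq> {}}"

text \<open>Vertices are taken to be natural numbers. As hypergraphs are finite, this is no
  restriction: see \<open>low_degree_colorable_any_type\<close> below.\<close>

definition low_degree_colorable :: "nat \<Rightarrow> nat \<Rightarrow> nat \<Rightarrow> bool" where
  "low_degree_colorable n r d \<longleftrightarrow>
     (\<forall>H :: nat hypergraph. hypergraph H \<and> uniform n H \<and> (\<forall>f\<in>snd H. edge_degree H f < d)
        \<longrightarrow> colorable r H)"

definition D :: "nat \<Rightarrow> nat \<Rightarrow> nat" where
  "D n r = (GREATEST d. low_degree_colorable n r d)"

lemma low_degree_colorable_any_type:
  fixes H :: "'a hypergraph"
  assumes L: "low_degree_colorable n r d"
    and H: "hypergraph H" "uniform n H" "\<And>f. f \<in> snd H \<Longrightarrow> edge_degree H f < d"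
  shows "colorable r H"
proof -
  obtain V E where VE: "H = (V, E)" by (cases H)
  have finV: "finite V" and sub: "\<And>e. e \<in> E \<Longrightarrow> e \<subseteq> V"
    using H(1) by (auto simp: VE hypergraph_def)
  obtain g :: "'a \<Rightarrow> nat" where inj: "inj_on g V"
    using finite_imp_inj_to_nat_seg[OF finV] by blast
  define H' where "H' = (g ` V, (`) g ` E)"
  have "hypergraph H'" using finV sub by (auto simp: H'_def hypergraph_def)
  moreover have "uniform n H'"
    using H(2) sub by (auto simp: H'_def VE uniform_def card_image inj_on_subset[OF inj])
  moreover have "edge_degree H' f' < d" if "f' \<in> snd H'" for f'
  proof -
    obtain f where f: "f \<in> E" "f' = g ` f" using \<open>f' \<in> snd H'\<close> by (auto simp: H'_def)
    have "{e' \<in> (`) g ` E. e' \<noteq> g ` f \<and> e' \<inter> g ` f \<noteq> {}}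
        \<subseteq> (`) g ` {e \<in> E. e \<noteq> f \<and> e \<inter> f \<noteq> {}}"
    proof
      fix e' assume "e' \<in> {e' \<in> (`) g ` E. e' \<noteq> g ` f \<and> e' \<inter> g ` f \<noteq> {}}"
      then obtain e where e: "e \<in> E" "e' = g ` e" "g ` e \<noteq> g ` f" "g ` e \<inter> g ` f \<noteq> {}"
        by blast
      have "g ` (e \<inter> f) = g ` e \<inter> g ` f"
        using inj_on_image_Int[OF inj] sub e(1) f(1) by blast
      with e show "e' \<in> (`) g ` {e \<in> E. e \<noteq> f \<and> e \<inter> f \<noteq> {}}" by auto
    qed
    moreover have "finite E" using finV sub by (meson finite_Pow_iff PowI finite_subset subsetI)
    ultimately have "edge_degree H' f' \<le> edge_degree H f"
      unfolding edge_degree_def H'_def VE f(2) by (simp add: surj_card_le)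
    also have "\<dots> < d" using H(3) f(1) by (simp add: VE)
    finally show ?thesis .
  qed
  ultimately have "colorable r H'" using L unfolding low_degree_colorable_def by blast
  then obtain c where c: "c ` g ` V \<subseteq> {1..r}" "\<And>e. e \<in> E \<Longrightarrow> 2 \<le> card (c ` g ` e)"
    by (auto simp: colorable_def H'_def)
  show ?thesis
    unfolding colorable_def VE using c by (intro exI[of _ "c \<circ> g"]) (auto simp: image_comp)
qed

text \<open>The maximum defining \<^const>\<open>D\<close> exists: the complete \<open>n\<close>-uniform hypergraph on
  \<open>r * n + 1\<close> vertices is not \<open>r\<close>-colorable.\<close>

lemma low_degree_colorable_bounded:
  assumes "low_degree_colorable n r d"
  shows "d \<le> 2 ^ (r * n + 1)"
proof (rule ccontr)
  assume big: "\<not> d \<le> 2 ^ (r * n + 1)"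
  define V where "V = {..<r * n + 1}"
  define H where "H = (V, {e. e \<subseteq> V \<and> card e = n})"
  have finV: "finite V" and cV: "card V = r * n + 1" by (auto simp: V_def)
  have "edge_degree H f < d" for f
  proof -
    have "edge_degree H f \<le> card (Pow V)"
      unfolding edge_degree_def H_def using finV by (intro card_mono) auto
    with big show ?thesis by (simp add: card_Pow[OF finV] cV)
  qed
  moreover have "hypergraph H" "uniform n H"
    using finV by (auto simp: H_def hypergraph_def uniform_def)
  ultimately have "colorable r H" using assms unfolding low_degree_colorable_def by blast
  then obtain c :: "nat \<Rightarrow> nat" where c: "c ` V \<subseteq> {1..r}"
    and mono: "\<And>e. e \<subseteq> V \<Longrightarrow> card e = n \<Longrightarrow> 2 \<le> card (c ` e)"
    by (auto simp: colorable_def H_def)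
  have "\<exists>i\<in>{1..r}. n \<le> card {v \<in> V. c v = i}"
  proof (rule ccontr)
    assume "\<not> ?thesis"
    then have le: "\<And>i. i \<in> {1..r} \<Longrightarrow> card {v \<in> V. c v = i} \<le> n" by force
    have "V \<subseteq> (\<Union>i\<in>{1..r}. {v \<in> V. c v = i})" using c by blast
    then have "card V \<le> card (\<Union>i\<in>{1..r}. {v \<in> V. c v = i})"
      by (rule card_mono[rotated]) (simp add: finV)
    also have "\<dots> \<le> (\<Sum>i\<in>{1..r}. card {v \<in> V. c v = i})"
      by (rule card_UN_le) simp
    also have "\<dots> \<le> r * n" using sum_bounded_above[OF le, of "{1..r}"] by simp
    finally show False by (simp add: cV)
  qed
  then obtain i where "n \<le> card {v \<in> V. c v = i}" by blast
  then obtain e where e: "e \<subseteq> {v \<in> V. c v = i}" "card e = n"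
    by (meson obtain_subset_with_card_n)
  then have "c ` e \<subseteq> {i}" by auto
  then have "card (c ` e) \<le> 1" using card_mono[of "{i}" "c ` e"] by simp
  with mono[of e] e show False by auto
qed

lemma D_is_maximum:
  assumes "r \<ge> 1"
  shows "low_degree_colorable n r (D n r)"
    and "low_degree_colorable n r d \<Longrightarrow> d \<le> D n r"
proof -
  have zero: "low_degree_colorable n r 0"
    unfolding low_degree_colorable_def colorable_def
    using assms by (auto intro!: exI[of _ "\<lambda>_. 1"])
  show "low_degree_colorable n r (D n r)"
    unfolding D_def using zero low_degree_colorable_bounded by (rule GreatestI_nat)
  show "d \<le> D n r" if "low_degree_colorable n r d"
    unfolding D_def using that low_degree_colorable_bounded by (rule Greatest_le_nat)
qed

end

theory Submission
  imports Defs "HOL-Library.FuncSet" "HOL-Library.Product_Lexorder"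
begin

text \<open>Give each vertex an independent random weight in \<open>{..<M}\<close> and colour it by the length of
  a longest chain of edges ending in it, where consecutive edges \<open>e\<close>, \<open>e'\<close> of a chain satisfy
  \<open>last e = first e'\<close> with respect to the weights. If there is no chain of \<open>r\<close> edges, this is a
  proper colouring with \<open>r\<close> colours.

  Put \<open>L = (1 - p) M / r\<close> with \<open>p\<close> about \<open>4 ln n / n\<close>. An edge is narrow, i.e. its weights span
  less than \<open>L\<close>, with probability at most \<open>n ((1 - p) / r)^(n - 1)\<close>. If all edges of a chain of
  length \<open>r\<close> are wide, then each of its \<open>r - 1\<close> joints lies in a prescribed window of length \<open>p M\<close>,
  so such a chain occurs with probability of order at most \<open>p^(r - 1) r^(-r n)\<close>. The local
  lemma, applied to the narrow edges and the wide chains, yields a weighting that avoids them all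
  as long as the degrees are below \<open>c (n / ln n)^((r - 1) / r) r^n\<close>.\<close>

subsection \<open>The local lemma on a finite product space\<close>

text \<open>Probabilities are ratios of cardinalities, and independence from the avoidance of
  non-neighbours is a counting identity. If neighbouring probabilities sum to at most 1/4,
  conditioning on the avoidance of other events at most doubles the probability of an event, so
  avoiding the events one by one always leaves something.\<close>

lemma local_lemma:
  fixes A :: "'i \<Rightarrow> 'w set"
  assumes fin: "finite \<Omega>" "\<Omega> \<noteq> {}" "finite I"
    and sub: "\<And>i. i \<in> I \<Longrightarrow> A i \<subseteq> \<Omega>"
    and refl: "\<And>i. i \<in> I \<Longrightarrow> adj i i"
    and indep: "\<And>i S. i \<in> I \<Longrightarrow> S \<subseteq> I \<Longrightarrow> (\<And>j. j \<in> S \<Longrightarrow> \<not> adj i j) \<Longrightarrow>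
      card (A i \<inter> (\<Omega> - \<Union>(A ` S))) * card \<Omega> = card (A i) * card (\<Omega> - \<Union>(A ` S))"
    and small: "\<And>i. i \<in> I \<Longrightarrow> (\<Sum>j | j \<in> I \<and> adj i j. real (card (A j)) / card \<Omega>) \<le> 1 / 4"
  shows "\<Omega> - \<Union>(A ` I) \<noteq> {}"
proof -
  define N where "N S = \<Omega> - \<Union>(A ` S)" for S
  define P where "P X = real (card X) / card \<Omega>" for X :: "'w set"
  have pos\<Omega>: "card \<Omega> > 0" using fin by auto
  have finN: "finite (N S)" for S using fin by (simp add: N_def)
  have P_mono: "P X \<le> P Y" if "X \<subseteq> Y" "finite Y" for X Y
    using that by (auto simp: P_def intro!: divide_right_mono card_mono)
  have P_nonneg: "P X \<ge> 0" for X by (simp add: P_def)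
  have insertN: "P (N (insert i S)) = P (N S) - P (A i \<inter> N S)" if "i \<in> I" for i S
  proof -
    have "N (insert i S) = N S - (A i \<inter> N S)" by (auto simp: N_def)
    then have "card (N (insert i S)) = card (N S) - card (A i \<inter> N S)"
      using finN[of S] by (simp add: card_Diff_subset)
    moreover have "card (A i \<inter> N S) \<le> card (N S)" using finN[of S] by (simp add: card_mono)
    ultimately show ?thesis by (simp add: P_def diff_divide_distrib)
  qed
  have ind: "P (A i \<inter> N S) = P (A i) * P (N S)"
    if "i \<in> I" "S \<subseteq> I" "\<And>j. j \<in> S \<Longrightarrow> \<not> adj i j" for i S
  proof -
    have "real (card (A i \<inter> N S)) * card \<Omega> = real (card (A i)) * card (N S)"
      using indep[OF that] unfolding N_def by (metis of_nat_mult)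
    then show ?thesis using pos\<Omega> by (simp add: P_def field_simps)
  qed
  \<comment> \<open>This is the bound on a conditional probability, multiplied out so that the
    induction need not know \<open>P (N S)\<close> to be positive.\<close>
  have key: "P (A i \<inter> N S) \<le> 2 * P (A i) * P (N S)" if "i \<in> I" "S \<subseteq> I" for i S
    using that
  proof (induction "card S" arbitrary: i S rule: less_induct)
    case less
    have finS: "finite S" using less.prems fin finite_subset by blast
    define S1 where "S1 = {j \<in> S. adj i j}"
    define S2 where "S2 = {j \<in> S. \<not> adj i j}"
    have S: "S = S1 \<union> S2" "S1 \<subseteq> I" "S2 \<subseteq> I" "finite S1"
      using less.prems finS by (auto simp: S1_def S2_def)
    have indS2: "P (A i \<inter> N S2) = P (A i) * P (N S2)"
      using less.prems by (intro ind) (auto simp: S2_def)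
    have le: "P (A i \<inter> N S) \<le> P (A i) * P (N S2)"
      unfolding indS2[symmetric] by (rule P_mono) (auto simp: N_def S(1) fin)
    \<comment> \<open>The neighbours in \<open>S1\<close> remove at most half of
      \<open>N S2\<close>: by the union bound and the induction hypothesis for \<open>S2\<close>,
      their share is at most 2 * 1/4. The case of empty \<open>S1\<close> is separate because
      \<open>S2\<close> is then not smaller than \<open>S\<close>.\<close>
    have half: "P (N S2) \<le> 2 * P (N S)"
    proof (cases "S1 = {}")
      case True
      then show ?thesis using S P_nonneg[of "N S2"] by simp
    next
      case False
      then have smaller: "card S2 < card S"
        using finS by (intro psubset_card_mono) (auto simp: S1_def S2_def)
      have "N S2 = N S \<union> (\<Union>j\<in>S1. A j \<inter> N S2)" by (auto simp: N_def S(1))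
      then have "card (N S2) \<le> card (N S) + card (\<Union>j\<in>S1. A j \<inter> N S2)"
        by (metis card_Un_le)
      also have "\<dots> \<le> card (N S) + (\<Sum>j\<in>S1. card (A j \<inter> N S2))"
        using card_UN_le[OF S(4), of "\<lambda>j. A j \<inter> N S2"] by simp
      finally have "real (card (N S2)) \<le> real (card (N S) + (\<Sum>j\<in>S1. card (A j \<inter> N S2)))"
        by (simp only: of_nat_le_iff)
      then have "P (N S2) \<le> P (N S) + (\<Sum>j\<in>S1. P (A j \<inter> N S2))"
        unfolding P_def sum_divide_distrib[symmetric] add_divide_distrib[symmetric]
        by (intro divide_right_mono) simp_all
      also have "(\<Sum>j\<in>S1. P (A j \<inter> N S2)) \<le> (\<Sum>j\<in>S1. 2 * P (A j) * P (N S2))"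
        using S smaller by (intro sum_mono less.hyps) auto
      also have "\<dots> = 2 * P (N S2) * (\<Sum>j\<in>S1. P (A j))"
        by (simp add: sum_distrib_left mult_ac)
      also have "(\<Sum>j\<in>S1. P (A j)) \<le> (\<Sum>j | j \<in> I \<and> adj i j. P (A j))"
        using less.prems fin P_nonneg by (intro sum_mono2) (auto simp: S1_def)
      also have "\<dots> \<le> 1 / 4" using small less.prems by (simp add: P_def)
      finally show ?thesis using P_nonneg[of "N S2"] by (simp add: mult_left_mono)
    qed
    have "P (A i) * P (N S2) \<le> P (A i) * (2 * P (N S))"
      by (intro mult_left_mono half P_nonneg)
    with le show ?case by simp
  qed
  have "P (N S) > 0" if "S \<subseteq> I" for S
    using finite_subset[OF that fin(3)] that
  proof (induction S rule: finite_induct)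
    case empty
    then show ?case using pos\<Omega> by (simp add: N_def P_def)
  next
    case (insert i S)
    \<comment> \<open>By \<open>refl\<close>, \<open>i\<close> occurs in its own neighbourhood sum;
      so \<open>P (A i)\<close> is at most 1/4, and each insertion keeps at least half of
      \<open>N S\<close>.\<close>
    have "P (A i) \<le> (\<Sum>j | j \<in> I \<and> adj i j. P (A j))"
      using insert.prems fin P_nonneg refl by (intro member_le_sum) auto
    also have "\<dots> \<le> 1 / 4" using small insert.prems by (simp add: P_def)
    finally have "2 * P (A i) * P (N S) \<le> P (N S) / 2"
      using mult_right_mono[of "P (A i)" "1 / 4" "P (N S)"] P_nonneg by simp
    moreover have "P (A i \<inter> N S) \<le> 2 * P (A i) * P (N S)"
      using insert.prems by (intro key) auto
    moreover have "P (N S) > 0" using insert by auto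
    moreover have "P (N (insert i S)) = P (N S) - P (A i \<inter> N S)"
      using insert.prems by (intro insertN) auto
    ultimately show ?case by linarith
  qed
  then have "P (N I) > 0" by blast
  then have "N I \<noteq> {}" by (auto simp: P_def)
  then show ?thesis by (simp add: N_def)
qed

text \<open>The combinatorial form of measurability with respect to the coordinates in
  \<open>S\<close>. A single implication expresses it, as \<open>f\<close> and \<open>g\<close> can
  be exchanged.\<close>

definition determined_by :: "('a \<Rightarrow> 'b) set \<Rightarrow> ('a \<Rightarrow> 'b) set \<Rightarrow> 'a set \<Rightarrow> bool" where
  "determined_by \<Omega> A S \<longleftrightarrow> (\<forall>f\<in>\<Omega>. \<forall>g\<in>\<Omega>. (\<forall>x\<in>S. f x = g x) \<longrightarrow> f \<in> A \<longrightarrow> g \<in> A)"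

lemma determined_byD:
  "determined_by \<Omega> A S \<Longrightarrow> f \<in> A \<Longrightarrow> f \<in> \<Omega> \<Longrightarrow> g \<in> \<Omega> \<Longrightarrow> (\<And>x. x \<in> S \<Longrightarrow> f x = g x) \<Longrightarrow> g \<in> A"
  unfolding determined_by_def by blast

text \<open>Exchanging two functions on \<open>S\<close> is an involution that maps
  \<open>(A \<inter> B) \<times> \<Omega>\<close> onto \<open>A \<times> B\<close>.\<close>

lemma card_Int_disjoint_supports:
  fixes B :: "'a \<Rightarrow> 'b set" and V :: "'a set"
  defines "\<Omega> \<equiv> PiE V B"
  assumes sub: "A \<subseteq> \<Omega>" "C \<subseteq> \<Omega>"
    and det: "determined_by \<Omega> A S" "determined_by \<Omega> C T" and disj: "S \<inter> T = {}"
  shows "card (A \<inter> C) * card \<Omega> = card A * card C"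
proof -
  \<comment> \<open>The first component agrees with \<open>f\<close> on \<open>S\<close>, which
    decides membership in \<open>A\<close>; the second agrees with \<open>f\<close> off
    \<open>S\<close>, in particular on \<open>T\<close>, which decides membership in
    \<open>C\<close>.\<close>
  define swap where "swap = (\<lambda>(f :: 'a \<Rightarrow> 'b, g). (override_on g f S, override_on f g S))"
  have override: "override_on g f S \<in> \<Omega>" if "f \<in> \<Omega>" "g \<in> \<Omega>" for f g
    using that by (auto simp: \<Omega>_def PiE_iff override_on_def extensional_def)
  have inv: "swap (swap z) = z" for z
    by (cases z) (auto simp: swap_def override_on_def fun_eq_iff)
  have 1: "swap z \<in> A \<times> C" if z0: "z \<in> (A \<inter> C) \<times> \<Omega>" for z
  proof -
    obtain f g where z: "z = (f, g)" "f \<in> A" "f \<in> C" "g \<in> \<Omega>" using z0 by (cases z) auto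
    have f: "f \<in> \<Omega>" using z sub by auto
    have "override_on g f S \<in> A"
      using z f by (intro determined_byD[OF det(1) \<open>f \<in> A\<close>] override) auto
    moreover have "override_on f g S \<in> C"
      using z f disj by (intro determined_byD[OF det(2) \<open>f \<in> C\<close>] override) (auto simp: override_on_def)
    ultimately show ?thesis using z by (simp add: swap_def)
  qed
  have 2: "swap z \<in> (A \<inter> C) \<times> \<Omega>" if z0: "z \<in> A \<times> C" for z
  proof -
    obtain f g where z: "z = (f, g)" "f \<in> A" "g \<in> C" using z0 by (cases z) auto
    have fg: "f \<in> \<Omega>" "g \<in> \<Omega>" using z sub by auto
    have "override_on g f S \<in> A"
      using z fg by (intro determined_byD[OF det(1) \<open>f \<in> A\<close>] override) auto
    moreover have "override_on g f S \<in> C"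
      using z fg disj by (intro determined_byD[OF det(2) \<open>g \<in> C\<close>] override) (auto simp: override_on_def)
    ultimately show ?thesis using z fg override by (simp add: swap_def)
  qed
  have "bij_betw swap ((A \<inter> C) \<times> \<Omega>) (A \<times> C)"
    by (rule bij_betw_byWitness[where f' = swap])
      (use inv 1 2 in \<open>blast intro!: image_subsetI\<close>)+
  then show ?thesis using bij_betw_same_card by (fastforce simp: card_cartesian_product)
qed

text \<open>Events are adjacent when their supports meet. Avoiding all events of a family is
  determined by the union of their supports, so disjointness from \<open>s i\<close> gives the
  required independence. Nonempty supports make adjacency reflexive.\<close>

lemma product_local_lemma:
  fixes A :: "'i \<Rightarrow> ('a \<Rightarrow> 'b) set" and B :: "'a \<Rightarrow> 'b set" and V :: "'a set"
  defines "\<Omega> \<equiv> PiE V B"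
  assumes "finite \<Omega>" "\<Omega> \<noteq> {}" "finite I"
    and sub: "\<And>i. i \<in> I \<Longrightarrow> A i \<subseteq> \<Omega>"
    and det: "\<And>i. i \<in> I \<Longrightarrow> determined_by \<Omega> (A i) (s i)"
    and ne: "\<And>i. i \<in> I \<Longrightarrow> s i \<noteq> {}"
    and small: "\<And>i. i \<in> I \<Longrightarrow> (\<Sum>j | j \<in> I \<and> s i \<inter> s j \<noteq> {}. real (card (A j)) / card \<Omega>) \<le> 1 / 4"
  shows "\<exists>f\<in>\<Omega>. \<forall>i\<in>I. f \<notin> A i"
proof -
  have "\<Omega> - \<Union>(A ` I) \<noteq> {}"
  proof (rule local_lemma[where adj = "\<lambda>i j. s i \<inter> s j \<noteq> {}"])
    fix i S assume i: "i \<in> I" "S \<subseteq> I" "\<And>j. j \<in> S \<Longrightarrow> \<not> s i \<inter> s j \<noteq> {}"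
    have "determined_by \<Omega> (\<Omega> - \<Union>(A ` S)) (\<Union>(s ` S))"
      unfolding determined_by_def
    proof (intro ballI impI)
      fix f g assume fg: "f \<in> \<Omega>" "g \<in> \<Omega>" "\<forall>x\<in>\<Union>(s ` S). f x = g x" "f \<in> \<Omega> - \<Union>(A ` S)"
      have "g \<notin> A j" if j: "j \<in> S" for j
      proof
        assume "g \<in> A j"
        moreover have "determined_by \<Omega> (A j) (s j)" using det i j by auto
        ultimately have "f \<in> A j"
          using fg j by (elim determined_byD) auto
        with fg j show False by auto
      qed
      with fg show "g \<in> \<Omega> - \<Union>(A ` S)" by auto
    qed
    moreover have "s i \<inter> \<Union>(s ` S) = {}" using i by blast
    ultimately show "card (A i \<inter> (\<Omega> - \<Union>(A ` S))) * card \<Omega> = card (A i) * card (\<Omega> - \<Union>(A ` S))"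
      unfolding \<Omega>_def using i sub det
      by (intro card_Int_disjoint_supports[where S = "s i" and T = "\<Union>(s ` S)"]) (auto simp: \<Omega>_def)
  qed (use assms in auto)
  then show ?thesis by blast
qed

subsection \<open>Colouring by longest chains\<close>

text \<open>The last vertex of an edge gets a larger colour than the first.\<close>

lemma colorable_if_no_long_chain:
  fixes H :: "'a hypergraph" and h :: "'a \<Rightarrow> 'b::linorder"
  defines "R \<equiv> {(u, w). \<exists>e\<in>snd H. u \<in> e \<and> w \<in> e \<and> (\<forall>x\<in>e. h u \<le> h x \<and> h x \<le> h w)}"
  assumes edges: "\<And>e. e \<in> snd H \<Longrightarrow> finite e \<and> e \<noteq> {}" and "r \<ge> 1" and none: "R ^^ r = {}"
  shows "colorable r H"
proof -
  \<comment> \<open>Truncation at \<open>r\<close> makes the set of chain lengths finite and keeps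
    the colours in \<open>{1..r}\<close>. It loses nothing: a chain that would reach length
    \<open>r\<close> contradicts \<open>none\<close>.\<close>
  define K where "K v = {k. k < r \<and> (\<exists>u. (u, v) \<in> R ^^ k)}" for v
  have finK: "finite (K v)" and K0: "0 \<in> K v" for v using \<open>r \<ge> 1\<close> by (auto simp: K_def)
  have MaxK: "Max (K v) \<in> K v" for v using finK K0 by (intro Max_in) auto
  define c where "c v = Suc (Max (K v))" for v
  have "c v \<in> {1..r}" for v using MaxK[of v] by (auto simp: c_def K_def)
  moreover have step: "c u < c w" if "(u, w) \<in> R" for u w
  proof -
    obtain a where a: "(a, u) \<in> R ^^ Max (K u)" "Max (K u) < r" using MaxK[of u] by (auto simp: K_def)
    then have "(a, w) \<in> R ^^ Suc (Max (K u))" using that by auto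
    moreover from this have "Suc (Max (K u)) \<noteq> r" using none by (metis empty_iff)
    ultimately have "Suc (Max (K u)) \<in> K w" using a(2) by (auto simp: K_def)
    then have "Suc (Max (K u)) \<le> Max (K w)" using finK by simp
    then show ?thesis by (simp add: c_def)
  qed
  moreover have "2 \<le> card (c ` e)" if e: "e \<in> snd H" for e
  proof -
    have fe: "finite e" "e \<noteq> {}" using edges e by auto
    obtain u where u: "u \<in> e" "\<forall>x\<in>e. h u \<le> h x"
      using ex_min_if_finite[of "h ` e"] fe by (auto simp: not_less)
    obtain w where w: "w \<in> e" "\<forall>x\<in>e. h x \<le> h w"
      using Max_in[of "h ` e"] Max_ge[of "h ` e"] fe by fastforce
    have "c u < c w" using u w e by (intro step) (auto simp: R_def)
    moreover have "{c u, c w} \<subseteq> c ` e" using u w by auto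
    ultimately show ?thesis using card_mono[of "c ` e" "{c u, c w}"] fe by auto
  qed
  ultimately show ?thesis unfolding colorable_def by (intro exI[of _ c]) auto
qed

section \<open>Counting walks in a graph of bounded degree\<close>

lemma card_walks_from:
  fixes F :: "'a set"
  assumes adj: "\<And>y. y \<in> E \<Longrightarrow> card {z \<in> E. R y z} \<le> d" and "finite E"
    and "F \<subseteq> E"
  shows "card {xs. length xs = Suc k \<and> set xs \<subseteq> E \<and> successively R xs \<and> hd xs \<in> F} \<le> card F * d ^ k"
  using \<open>F \<subseteq> E\<close>
proof (induction k arbitrary: F)
  case 0
  have "{xs. length xs = Suc 0 \<and> set xs \<subseteq> E \<and> successively R xs \<and> hd xs \<in> F} \<subseteq> (\<lambda>x. [x]) ` F"
    by (auto simp: length_Suc_conv)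
  moreover have "finite F" using 0 \<open>finite E\<close> finite_subset by auto
  ultimately show ?case by (simp add: surj_card_le)
next
  case (Suc k)
  define W where "W F = {xs. length xs = Suc k \<and> set xs \<subseteq> E \<and> successively R xs \<and> hd xs \<in> F}" for F
  have finF: "finite F" using Suc.prems \<open>finite E\<close> finite_subset by auto
  have finW: "finite (W F)" for F
    by (rule finite_subset[OF _ finite_lists_length_eq[OF \<open>finite E\<close>, of "Suc k"]]) (auto simp: W_def)
  have "{xs. length xs = Suc (Suc k) \<and> set xs \<subseteq> E \<and> successively R xs \<and> hd xs \<in> F}
      \<subseteq> (\<lambda>(y, ys). y # ys) ` (SIGMA y:F. W {z \<in> E. R y z})"
  proof
    fix xs assume xs: "xs \<in> {xs. length xs = Suc (Suc k) \<and> set xs \<subseteq> E \<and> successively R xs \<and> hd xs \<in> F}"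
    then obtain y z zs where "xs = y # z # zs" by (auto simp: length_Suc_conv)
    with xs show "xs \<in> (\<lambda>(y, ys). y # ys) ` (SIGMA y:F. W {z \<in> E. R y z})"
      by (auto simp: W_def image_iff)
  qed
  then have "card {xs. length xs = Suc (Suc k) \<and> set xs \<subseteq> E \<and> successively R xs \<and> hd xs \<in> F}
      \<le> card (SIGMA y:F. W {z \<in> E. R y z})"
    using finF finW by (intro surj_card_le) auto
  also have "\<dots> = (\<Sum>y\<in>F. card (W {z \<in> E. R y z}))" using finF finW by (intro card_SigmaI) auto
  also have "\<dots> \<le> (\<Sum>y\<in>F. d * d ^ k)"
  proof (rule sum_mono)
    fix y assume "y \<in> F"
    have "card (W {z \<in> E. R y z}) \<le> card {z \<in> E. R y z} * d ^ k"
      unfolding W_def by (rule Suc.IH) auto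
    also have "\<dots> \<le> d * d ^ k" using adj \<open>y \<in> F\<close> Suc.prems by (intro mult_right_mono) auto
    finally show "card (W {z \<in> E. R y z}) \<le> d * d ^ k" .
  qed
  finally show ?case by simp
qed

text \<open>Leading entries are removed until the prescribed one comes first, where
  \<open>card_walks_from\<close> applies. By symmetry, each removed entry is one of at most
  \<open>d\<close> neighbours of its successor.\<close>

lemma card_walks_through:
  fixes F :: "'a set"
  assumes adj: "\<And>y. y \<in> E \<Longrightarrow> card {z \<in> E. R y z} \<le> d"
    and sym: "\<And>y z. R y z \<Longrightarrow> R z y" and "finite E" and "F \<subseteq> E" and "j \<le> k"
  shows "card {xs. length xs = Suc k \<and> set xs \<subseteq> E \<and> successively R xs \<and> xs ! j \<in> F} \<le> card F * d ^ k"
  using \<open>j \<le> k\<close>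
proof (induction k arbitrary: j)
  case 0
  have "{xs. length xs = Suc 0 \<and> set xs \<subseteq> E \<and> successively R xs \<and> xs ! 0 \<in> F} \<subseteq> (\<lambda>x. [x]) ` F"
    by (auto simp: length_Suc_conv)
  moreover have "finite F" using \<open>finite E\<close> \<open>F \<subseteq> E\<close> finite_subset by auto
  ultimately show ?case using 0 by (simp add: surj_card_le)
next
  case (Suc k)
  define W where "W = {xs. length xs = Suc k \<and> set xs \<subseteq> E \<and> successively R xs \<and> xs ! (j - 1) \<in> F}"
  have finW: "finite W"
    by (rule finite_subset[OF _ finite_lists_length_eq[OF \<open>finite E\<close>, of "Suc k"]]) (auto simp: W_def)
  show ?case
  proof (cases j)
    case 0
    have "{xs. length xs = Suc (Suc k) \<and> set xs \<subseteq> E \<and> successively R xs \<and> xs ! j \<in> F}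
      = {xs. length xs = Suc (Suc k) \<and> set xs \<subseteq> E \<and> successively R xs \<and> hd xs \<in> F}"
      using 0 by (auto simp: hd_conv_nth length_Suc_conv)
    then show ?thesis using card_walks_from[where k = "Suc k", OF adj \<open>finite E\<close> \<open>F \<subseteq> E\<close>] by simp
  next
    case (Suc i)
    have "{xs. length xs = Suc (Suc k) \<and> set xs \<subseteq> E \<and> successively R xs \<and> xs ! j \<in> F}
        \<subseteq> (\<lambda>(ys, y). y # ys) ` (SIGMA ys:W. {z \<in> E. R (hd ys) z})"
    proof
      fix xs assume xs: "xs \<in> {xs. length xs = Suc (Suc k) \<and> set xs \<subseteq> E \<and> successively R xs \<and> xs ! j \<in> F}"
      then obtain y z zs where "xs = y # z # zs" by (auto simp: length_Suc_conv)
      with xs Suc show "xs \<in> (\<lambda>(ys, y). y # ys) ` (SIGMA ys:W. {z \<in> E. R (hd ys) z})"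
        by (auto simp: W_def image_iff intro: sym)
    qed
    then have "card {xs. length xs = Suc (Suc k) \<and> set xs \<subseteq> E \<and> successively R xs \<and> xs ! j \<in> F}
        \<le> card (SIGMA ys:W. {z \<in> E. R (hd ys) z})"
      using \<open>finite E\<close> finW by (intro surj_card_le) auto
    also have "\<dots> = (\<Sum>ys\<in>W. card {z \<in> E. R (hd ys) z})"
      using \<open>finite E\<close> finW by (intro card_SigmaI) auto
    also have "\<dots> \<le> (\<Sum>ys\<in>W. d)"
    proof (rule sum_mono)
      fix ys assume "ys \<in> W"
      then have "hd ys \<in> E" unfolding W_def by (cases ys) auto
      then show "card {z \<in> E. R (hd ys) z} \<le> d" by (rule adj)
    qed
    also have "\<dots> = card W * d" by simp
    also have "\<dots> \<le> card F * d ^ k * d"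
      unfolding W_def using Suc Suc.prems by (intro mult_right_mono Suc.IH) auto
    finally show ?thesis by (simp add: mult_ac)
  qed
qed

subsection \<open>Narrow edges and wide chains\<close>

text \<open>The coordinates are independent, so the probability of a box is a product; the factors
  outside \<open>U\<close> are at most 1.\<close>

lemma card_PiE_le_prod:
  fixes B :: "'a \<Rightarrow> nat set"
  assumes "finite V" "U \<subseteq> V" "\<And>x. x \<in> V \<Longrightarrow> B x \<subseteq> {..<M}" "M > 0"
  shows "real (card (PiE V B)) / real M ^ card V \<le> (\<Prod>x\<in>U. real (card (B x)) / real M)"
proof -
  have le: "real (card (B x)) / real M \<le> 1" if "x \<in> V" for x
    using card_mono[OF _ assms(3)[OF that]] assms(4) by simp
  have "real (card (PiE V B)) / real M ^ card V = (\<Prod>x\<in>V. real (card (B x)) / real M)"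
    using assms(1) by (simp add: card_PiE prod_dividef)
  also have "\<dots> = (\<Prod>x\<in>U. real (card (B x)) / real M) * (\<Prod>x\<in>V - U. real (card (B x)) / real M)"
    using prod.subset_diff[OF assms(2,1)] by (simp add: mult.commute)
  also have "\<dots> \<le> (\<Prod>x\<in>U. real (card (B x)) / real M) * 1"
    using le by (intro mult_left_mono prod_le_1 prod_nonneg) auto
  finally show ?thesis by simp
qed

definition narrow :: "nat \<Rightarrow> (nat \<Rightarrow> nat) \<Rightarrow> nat set \<Rightarrow> bool" where
  "narrow L f e \<longleftrightarrow> (\<exists>u\<in>e. \<forall>x\<in>e. f u \<le> f x \<and> f x < f u + L)"

text \<open>Ties between equal weights are broken by the names of the vertices.\<close>

definition spans :: "(nat \<Rightarrow> nat) \<Rightarrow> nat set \<Rightarrow> nat \<Rightarrow> nat \<Rightarrow> bool" where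
  "spans f e u w \<longleftrightarrow> u \<in> e \<and> w \<in> e \<and> (\<forall>x\<in>e. (f u, u) \<le> (f x, x) \<and> (f x, x) \<le> (f w, w))"

text \<open>The values of \<open>v\<close> are the first vertex of the chain, its joints and its
  last vertex; that consecutive edges share \<open>v (Suc i)\<close> says that the last vertex of
  one is the first vertex of the next.\<close>

definition wide_chain :: "nat \<Rightarrow> (nat \<Rightarrow> nat) \<Rightarrow> nat set list \<Rightarrow> bool" where
  "wide_chain L f xs \<longleftrightarrow>
     (\<exists>v. \<forall>i<length xs. spans f (xs ! i) (v i) (v (Suc i)) \<and> f (v i) + L \<le> f (v (Suc i)))"

text \<open>Union bound over the vertex \<open>u\<close> of least weight and its weight
  \<open>a\<close>, which gives \<open>n * M\<close> cases. In each, \<open>u\<close> contributes a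
  factor \<open>1 / M\<close> and each of the other \<open>n - 1\<close> vertices at most
  \<open>L / M\<close>, for a window of \<open>L\<close> values.\<close>

lemma narrow_probability:
  assumes V: "finite V" "e \<subseteq> V" and n: "card e = n" "n > 0" and M: "M > 0"
  shows "real (card {f \<in> PiE V (\<lambda>_. {..<M}). narrow L f e}) / real M ^ card V
    \<le> real n * (real L / real M) ^ (n - 1)"
proof -
  define Bx where "Bx u a x = {y. y < M \<and> (x = u \<longrightarrow> y = a) \<and> (x \<in> e \<longrightarrow> a \<le> y \<and> y < a + L)}"
    for u a x :: nat
  have fin: "finite e" using V finite_subset by auto
  have finPiE: "finite (PiE V (Bx u a))" for u a
    using V(1) by (intro finite_PiE) (auto simp: Bx_def)
  have one: "real (card (PiE V (Bx u a))) / real M ^ card V \<le> (1 / real M) * (real L / real M) ^ (n - 1)"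
    if "u \<in> e" for u a
  proof -
    have "real (card (PiE V (Bx u a))) / real M ^ card V \<le> (\<Prod>x\<in>e. real (card (Bx u a x)) / real M)"
      using V M by (intro card_PiE_le_prod) (auto simp: Bx_def)
    also have "\<dots> = real (card (Bx u a u)) / real M * (\<Prod>x\<in>e - {u}. real (card (Bx u a x)) / real M)"
      using fin that by (simp add: prod.remove)
    also have "\<dots> \<le> (1 / real M) * (\<Prod>x\<in>e - {u}. real L / real M)"
    proof (intro mult_mono prod_mono conjI divide_right_mono)
      have "card (Bx u a u) \<le> card {a}" by (rule card_mono) (auto simp: Bx_def)
      then show "real (card (Bx u a u)) \<le> 1" by simp
      fix x assume x: "x \<in> e - {u}"
      then have "card (Bx u a x) \<le> card {a..<a + L}" by (intro card_mono) (auto simp: Bx_def)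
      then show "real (card (Bx u a x)) \<le> real L" by simp
    qed (auto intro!: prod_nonneg)
    also have "\<dots> = (1 / real M) * (real L / real M) ^ (n - 1)"
      using fin that n by (simp add: card_Diff_singleton)
    finally show ?thesis .
  qed
  have "{f \<in> PiE V (\<lambda>_. {..<M}). narrow L f e} \<subseteq> (\<Union>(u, a)\<in>e \<times> {..<M}. PiE V (Bx u a))"
  proof
    fix f assume "f \<in> {f \<in> PiE V (\<lambda>_. {..<M}). narrow L f e}"
    then have f: "f \<in> PiE V (\<lambda>_. {..<M})" and "narrow L f e" by auto
    then obtain u where u: "u \<in> e" "\<And>x. x \<in> e \<Longrightarrow> f u \<le> f x \<and> f x < f u + L"
      unfolding narrow_def by blast
    have "f \<in> PiE V (Bx u (f u))" using f u by (auto simp: PiE_iff Bx_def)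
    moreover have "f u < M" using f u V by (auto simp: PiE_iff)
    ultimately show "f \<in> (\<Union>(u, a)\<in>e \<times> {..<M}. PiE V (Bx u a))" using u by blast
  qed
  then have "card {f \<in> PiE V (\<lambda>_. {..<M}). narrow L f e} \<le> card (\<Union>(u, a)\<in>e \<times> {..<M}. PiE V (Bx u a))"
    using fin finPiE by (intro card_mono) auto
  also have "\<dots> \<le> (\<Sum>(u, a)\<in>e \<times> {..<M}. card (PiE V (Bx u a)))"
    using card_UN_le[of "e \<times> {..<M}" "\<lambda>(u, a). PiE V (Bx u a)"] fin
    by (simp add: case_prod_unfold)
  finally have "real (card {f \<in> PiE V (\<lambda>_. {..<M}). narrow L f e}) / real M ^ card V
      \<le> (\<Sum>(u, a)\<in>e \<times> {..<M}. real (card (PiE V (Bx u a)))) / real M ^ card V"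
    by (intro divide_right_mono) (simp_all add: case_prod_unfold flip: of_nat_sum)
  also have "\<dots> = (\<Sum>(u, a)\<in>e \<times> {..<M}. real (card (PiE V (Bx u a))) / real M ^ card V)"
    by (simp add: sum_divide_distrib case_prod_unfold)
  also have "\<dots> \<le> (\<Sum>(u, a)\<in>e \<times> {..<M}. (1 / real M) * (real L / real M) ^ (n - 1))"
    using one by (intro sum_mono) auto
  also have "\<dots> = real n * (real L / real M) ^ (n - 1)"
    using n M by (simp add: case_prod_unfold card_cartesian_product)
  finally show ?thesis .
qed

text \<open>An inequality of arithmetic and geometric means for blocks that cut the range of weights
  into \<open>r\<close> pieces. Neighbouring blocks share an endpoint, so the relative lengths sum
  to \<open>1 + (r - 1) / M\<close> rather than 1; the exponential factor pays for this. As no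
  length exceeds 1, all exponents may be lowered to \<open>k\<close>.\<close>

lemma prod_blocks_le:
  fixes a :: "nat \<Rightarrow> nat" and t :: "nat \<Rightarrow> nat"
  assumes a: "a 0 = 0" "a r = M - 1" "\<And>i. i < r \<Longrightarrow> a i \<le> a (Suc i)" and "M > 0" "r > 0"
    and t: "\<And>i. i < r \<Longrightarrow> k \<le> t i"
  shows "(\<Prod>i<r. (real (a (Suc i) - a i + 1) / real M) ^ t i)
    \<le> (exp (real r * (real r - 1) / real M) / real r ^ r) ^ k"
proof -
  define b where "b i = real (a (Suc i) - a i + 1) / real M" for i
  have b0: "b i \<ge> 0" for i by (simp add: b_def)
  have a_le: "a i \<le> M - 1" if "i \<le> r" for i
  proof -
    have "a i \<le> a r" using that
    proof (induction "r - i" arbitrary: i)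
      case (Suc j)
      then have "a (Suc i) \<le> a r" by (intro Suc.hyps) auto
      moreover have "a i \<le> a (Suc i)" using Suc by (intro a) auto
      ultimately show ?case by simp
    qed auto
    then show ?thesis by (simp add: a)
  qed
  have b1: "b i \<le> 1" if "i < r" for i
  proof -
    have "a (Suc i) - a i + 1 \<le> M" using a_le[of "Suc i"] that \<open>M > 0\<close> by linarith
    then show ?thesis using \<open>M > 0\<close> by (simp add: b_def del: of_nat_add)
  qed
  have sum_b: "(\<Sum>i<r. b i) = (real M - 1 + real r) / real M"
  proof -
    have "(\<Sum>i<r. b i) = (\<Sum>i<r. real (a (Suc i)) - real (a i) + 1) / real M"
      unfolding b_def sum_divide_distrib using a(3) by (intro sum.cong) (auto simp: of_nat_diff)
    also have "(\<Sum>i<r. real (a (Suc i)) - real (a i) + 1) = real (a r) - real (a 0) + real r"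
      using sum_lessThan_telescope[of "\<lambda>i. real (a i)" r] by (simp add: sum.distrib)
    finally show ?thesis using a \<open>M > 0\<close> by (simp add: of_nat_diff)
  qed
  have "(\<Prod>i<r. b i ^ t i) \<le> (\<Prod>i<r. b i ^ k)"
    using b0 b1 t by (intro prod_mono conjI power_decreasing) auto
  also have "\<dots> = (\<Prod>i<r. b i) ^ k" by (simp add: prod_power_distrib)
  also have "\<dots> \<le> (exp (real r * (real r - 1) / real M) / real r ^ r) ^ k"
  proof (intro power_mono prod_nonneg ballI b0)
    \<comment> \<open>The bound \<open>x \<le> exp (x - 1)\<close>, applied to each
      \<open>real r * b i\<close>, turns the product into the known sum.\<close>
    have "(\<Prod>i<r. real r * b i) \<le> (\<Prod>i<r. exp (real r * b i - 1))"
      using b0 exp_ge_add_one_self[of "real r * b _ - 1"] by (intro prod_mono) auto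
    also have "\<dots> = exp (real r * (\<Sum>i<r. b i) - real r)"
      by (simp add: exp_sum[symmetric] sum_subtractf sum_distrib_left)
    also have "real r * (\<Sum>i<r. b i) - real r = real r * (real r - 1) / real M"
      unfolding sum_b using \<open>M > 0\<close> by (simp add: field_simps)
    finally have "real r ^ r * (\<Prod>i<r. b i) \<le> exp (real r * (real r - 1) / real M)"
      by (simp add: prod.distrib)
    then show "(\<Prod>i<r. b i) \<le> exp (real r * (real r - 1) / real M) / real r ^ r"
      using \<open>r > 0\<close> by (simp add: field_simps)
  qed
  finally show ?thesis by (simp add: b_def)
qed

text \<open>The \<open>i\<close>-th joint of a chain has at least \<open>i\<close> edges of width \<open>L\<close> below it and at least
  \<open>r - i\<close> above it. This confines it to a window of length \<open>M - r * L\<close>.\<close>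

lemma wide_chain_probability:
  assumes V: "finite V" "\<And>e. e \<in> set xs \<Longrightarrow> e \<subseteq> V" and n: "\<And>e. e \<in> set xs \<Longrightarrow> card e = n"
    and r: "length xs = r" "r > 0" and L: "L > 0" and M: "M > 0" "r * L \<le> M"
  shows "real (card {f \<in> PiE V (\<lambda>_. {..<M}). wide_chain L f xs}) / real M ^ card V
    \<le> (real (M - r * L) / real M) ^ (r - 1) * (exp (real r * (real r - 1) / real M) / real r ^ r) ^ (n - 2)"
    (is "_ \<le> ?W * ?E")
proof (cases "{f \<in> PiE V (\<lambda>_. {..<M}). wide_chain L f xs} = {}")
  case True
  show ?thesis unfolding True by simp
next
  case False
  \<comment> \<open>One weighting with a wide chain reveals the structure of \<open>xs\<close>:
    consecutive edges meet in a single vertex, and the edges are otherwise disjoint. Hence the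
    joints \<open>w i\<close> are the same for every such weighting.\<close>
  then obtain g w where g: "\<And>i. i < r \<Longrightarrow> spans g (xs ! i) (w i) (w (Suc i)) \<and> g (w i) + L \<le> g (w (Suc i))"
    unfolding wide_chain_def using r by blast
  define key where "key x = (g x, x)" for x
  have key: "w i \<in> xs ! i \<and> w (Suc i) \<in> xs ! i" "x \<in> xs ! i \<Longrightarrow> key (w i) \<le> key x"
    "x \<in> xs ! i \<Longrightarrow> key x \<le> key (w (Suc i))" if "i < r" for i x
    using g[OF that] by (auto simp: spans_def key_def)
  have key_inj: "x = y" if "key x = key y" for x y using that by (simp add: key_def)
  have key_Suc: "key (w i) < key (w (Suc i))" if "i < r" for i
    using g[OF that] L by (auto simp: key_def)
  have key_less: "key (w i) < key (w j)" if "i < j" "j \<le> r" for i j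
    using that
  proof (induction j)
    case (Suc j)
    then show ?case using key_Suc[of j] by (cases "i = j") (auto intro: less_trans)
  qed simp
  define J where "J = w ` {1..<r}"
  have inj: "inj_on w {1..<r}"
  proof (rule inj_onI)
    fix i j assume "i \<in> {1..<r}" "j \<in> {1..<r}" "w i = w j"
    then show "i = j" using key_less[of i j] key_less[of j i] by (cases i j rule: linorder_cases) auto
  qed
  have cardJ: "card J = r - 1" unfolding J_def using card_image[OF inj] by simp
  \<comment> \<open>Removing the joints makes the edges disjoint and costs each at most two
    vertices, so the probability factors over \<open>J\<close> and the sets
    \<open>T i\<close>.\<close>
  define T where "T i = xs ! i - J" for i
  have edge: "xs ! i \<subseteq> V" "card (xs ! i) = n" "finite (xs ! i)" if "i < r" for i
  proof -
    have "xs ! i \<in> set xs" using that r by auto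
    then show "xs ! i \<subseteq> V" "card (xs ! i) = n" "finite (xs ! i)"
      using V n by (auto intro: finite_subset)
  qed
  have JV: "J \<subseteq> V" using key(1) edge(1) by (force simp: J_def)
  have finJ: "finite J" by (simp add: J_def)
  have cardT: "n - 2 \<le> card (T i)" if "i < r" for i
  proof -
    have "xs ! i \<inter> J \<subseteq> {w i, w (Suc i)}"
    proof
      fix x assume "x \<in> xs ! i \<inter> J"
      then obtain j where j: "x = w j" "1 \<le> j" "j < r" "x \<in> xs ! i" by (auto simp: J_def)
      have "key (w i) \<le> key (w j)" "key (w j) \<le> key (w (Suc i))" using key[OF that] j by auto
      then have "\<not> j < i" "\<not> Suc i < j" using key_less[of j i] key_less[of "Suc i" j] that j
        by (auto simp: not_le[symmetric])
      then have "j = i \<or> j = Suc i" by linarith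
      then show "x \<in> {w i, w (Suc i)}" using j by auto
    qed
    then have "card (xs ! i \<inter> J) \<le> card {w i, w (Suc i)}" by (intro card_mono) auto
    also have "\<dots> \<le> 2" by (simp add: card_insert_if)
    finally have "card (xs ! i \<inter> J) \<le> 2" .
    then show ?thesis unfolding T_def using edge[OF that] by (simp add: card_Diff_subset_Int)
  qed
  \<comment> \<open>With respect to \<open>key\<close>, edge \<open>i\<close> lies at or below the
    joint \<open>w j\<close> and edge \<open>j\<close> at or above it; a common vertex would be that
    joint.\<close>
  have disjT: "T i \<inter> T j = {}" if "i < j" "j < r" for i j
  proof -
    have False if x: "x \<in> T i" "x \<in> T j" for x
    proof -
      have "key x \<le> key (w (Suc i))" using key(3)[of i x] x \<open>i < j\<close> \<open>j < r\<close> by (auto simp: T_def)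
      also have "\<dots> \<le> key (w j)" using key_less[of "Suc i" j] \<open>i < j\<close> \<open>j < r\<close> by (cases "Suc i = j") auto
      also have "\<dots> \<le> key x" using key(2)[of j x] x \<open>j < r\<close> by (auto simp: T_def)
      finally have "x = w j"
        using \<open>key (w j) \<le> key x\<close> \<open>key x \<le> key (w (Suc i))\<close> \<open>key (w (Suc i)) \<le> key (w j)\<close>
        by (intro key_inj) auto
      then show False using x \<open>i < j\<close> \<open>j < r\<close> by (auto simp: T_def J_def)
    qed
    then show ?thesis by blast
  qed
  have joint: "x = w (Suc i)" if "x \<in> xs ! i" "x \<in> xs ! Suc i" "Suc i < r" for x i
    using key(3)[of i x] key(2)[of "Suc i" x] that by (intro key_inj) auto

  \<comment> \<open>The joint weights are completed by the least and the greatest possible weight,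
    so the end vertices of the chain, which may depend on the weighting, need not be fixed.\<close>
  define ext where "ext a i = (if i = 0 then 0 else if i = r then M - 1 else a i)" for a :: "nat \<Rightarrow> nat" and i
  define Bx where "Bx a x = {y. y < M \<and> (\<forall>i\<in>{1..<r}. x = w i \<longrightarrow> y = a i)
      \<and> (\<forall>i<r. x \<in> xs ! i \<longrightarrow> ext a i \<le> y \<and> y \<le> ext a (Suc i))}" for a x
  define win where "win i = {i * L..<M - (r - i) * L}" for i
  \<comment> \<open>The admissible vectors of joint weights. Confining them to the windows leaves at
    most \<open>(M - r * L) ^ (r - 1)\<close> cases in the union bound, which is the source of the
    factor \<open>?W\<close>.\<close>
  define \<A> where "\<A> = {a \<in> PiE {1..<r} win. \<forall>i<r. ext a i \<le> ext a (Suc i)}"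
  have finPiE: "finite (PiE {1..<r} win)" by (intro finite_PiE) (auto simp: win_def)
  then have fin\<A>: "finite \<A>" by (simp add: \<A>_def)
  have "card (win i) = M - r * L" if "i \<in> {1..<r}" for i
  proof -
    have "(r - i) * L + i * L = r * L" using that by (simp flip: add_mult_distrib)
    then show ?thesis by (simp add: win_def)
  qed
  then have "card (PiE {1..<r} win) = (M - r * L) ^ (r - 1)" by (simp add: card_PiE)
  then have card\<A>: "card \<A> \<le> (M - r * L) ^ (r - 1)"
    using card_mono[OF finPiE, of \<A>] by (auto simp: \<A>_def)
  have finB: "finite (PiE V (Bx a))" for a
    using V(1) by (intro finite_PiE) (auto simp: Bx_def)

  \<comment> \<open>With the joint weights fixed, each joint contributes a factor
    \<open>1 / M\<close>, and the vertices of \<open>T i\<close> are confined to the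
    \<open>i\<close>-th block.\<close>
  have one: "real (card (PiE V (Bx a))) / real M ^ card V \<le> (1 / real M) ^ (r - 1) * ?E" if a: "a \<in> \<A>" for a
  proof -
    define p where "p x = real (card (Bx a x)) / real M" for x
    have p0: "p x \<ge> 0" for x by (simp add: p_def)
    have "real (card (PiE V (Bx a))) / real M ^ card V \<le> (\<Prod>x\<in>J \<union> (\<Union>i<r. T i). p x)"
      unfolding p_def using V(1) M JV edge(1)
      by (intro card_PiE_le_prod) (auto simp: Bx_def T_def)
    also have "\<dots> = (\<Prod>x\<in>J. p x) * (\<Prod>x\<in>(\<Union>i<r. T i). p x)"
      using finJ edge(3) by (intro prod.union_disjoint) (auto simp: T_def)
    also have "(\<Prod>x\<in>(\<Union>i<r. T i). p x) = (\<Prod>i<r. \<Prod>x\<in>T i. p x)"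
    proof (rule prod.UNION_disjoint)
      show "\<forall>i\<in>{..<r}. \<forall>j\<in>{..<r}. i \<noteq> j \<longrightarrow> T i \<inter> T j = {}"
        using disjT by (metis lessThan_iff linorder_neqE_nat Int_commute)
    qed (use edge(3) in \<open>auto simp: T_def\<close>)
    also have "(\<Prod>x\<in>J. p x) * (\<Prod>i<r. \<Prod>x\<in>T i. p x)
        \<le> (1 / real M) ^ (r - 1) * (\<Prod>i<r. (real (ext a (Suc i) - ext a i + 1) / real M) ^ card (T i))"
    proof (intro mult_mono prod_nonneg ballI p0)
      have "(\<Prod>x\<in>J. p x) \<le> (\<Prod>x\<in>J. 1 / real M)"
      proof (intro prod_mono conjI p0)
        fix x assume "x \<in> J"
        then obtain i where i: "i \<in> {1..<r}" "x = w i" by (auto simp: J_def)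
        then have "card (Bx a x) \<le> card {a i}" by (intro card_mono) (auto simp: Bx_def)
        then show "p x \<le> 1 / real M" by (simp add: p_def divide_right_mono)
      qed
      then show "(\<Prod>x\<in>J. p x) \<le> (1 / real M) ^ (r - 1)" using cardJ by simp
      show "(\<Prod>i<r. \<Prod>x\<in>T i. p x) \<le> (\<Prod>i<r. (real (ext a (Suc i) - ext a i + 1) / real M) ^ card (T i))"
      proof (intro prod_mono conjI prod_nonneg ballI p0)
        fix i assume i: "i \<in> {..<r}"
        have "(\<Prod>x\<in>T i. p x) \<le> (\<Prod>x\<in>T i. real (ext a (Suc i) - ext a i + 1) / real M)"
        proof (intro prod_mono conjI p0)
          fix x assume "x \<in> T i"
          then have "card (Bx a x) \<le> card {ext a i..ext a (Suc i)}"
            using i by (intro card_mono) (auto simp: Bx_def T_def)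
          also have "\<dots> = ext a (Suc i) - ext a i + 1"
            using a i by (auto simp: \<A>_def Suc_diff_le)
          finally show "p x \<le> real (ext a (Suc i) - ext a i + 1) / real M"
            unfolding p_def by (intro divide_right_mono) (simp_all only: of_nat_le_iff of_nat_0_le_iff)
        qed
        then show "(\<Prod>x\<in>T i. p x) \<le> (real (ext a (Suc i) - ext a i + 1) / real M) ^ card (T i)"
          by simp
      qed
    qed auto
    also have "\<dots> \<le> (1 / real M) ^ (r - 1) * ?E"
      using a r M cardT by (intro mult_left_mono prod_blocks_le) (auto simp: ext_def \<A>_def)
    finally show ?thesis .
  qed

  have "{f \<in> PiE V (\<lambda>_. {..<M}). wide_chain L f xs} \<subseteq> (\<Union>a\<in>\<A>. PiE V (Bx a))"
  proof
    fix f assume "f \<in> {f \<in> PiE V (\<lambda>_. {..<M}). wide_chain L f xs}"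
    then obtain v where f: "f \<in> PiE V (\<lambda>_. {..<M})"
      and v: "\<And>i. i < r \<Longrightarrow> spans f (xs ! i) (v i) (v (Suc i)) \<and> f (v i) + L \<le> f (v (Suc i))"
      unfolding wide_chain_def using r by blast
    \<comment> \<open>An inner vertex of the chain lies in two consecutive edges, whose only common
      vertex is \<open>w i\<close>.\<close>
    have vw: "v i = w i" if "i \<in> {1..<r}" for i
      using joint[of "v i" "i - 1"] v[of "i - 1"] v[of i] that by (auto simp: spans_def)
    have vV: "v i \<in> V" if "i \<le> r" for i
    proof (cases i)
      case 0
      then show ?thesis using v[of 0] edge(1)[of 0] r by (auto simp: spans_def)
    next
      case (Suc j)
      then show ?thesis using v[of j] edge(1)[of j] that by (auto simp: spans_def)
    qed
    then have fM: "f (v i) < M" if "i \<le> r" for i using f that by (auto simp: PiE_iff)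
    have low: "i * L \<le> f (v i)" if "i \<le> r" for i
      using that
    proof (induction i)
      case (Suc i)
      then show ?case using v[of i] by simp
    qed simp
    have high: "f (v (r - i)) + i * L < M" if "i \<le> r" for i
      using that
    proof (induction i)
      case 0
      then show ?case using fM by simp
    next
      case (Suc i)
      then have "Suc (r - Suc i) = r - i" by simp
      then show ?case using v[of "r - Suc i"] Suc by simp
    qed
    define a where "a = restrict (\<lambda>i. f (w i)) {1..<r}"
    have ext: "ext a i \<le> f x \<and> f x \<le> ext a (Suc i)" if "i < r" "x \<in> xs ! i" for i x
    proof
      have s: "f (v i) \<le> f x" "f x \<le> f (v (Suc i))" using v[OF that(1)] that(2) by (auto simp: spans_def)
      have "x \<in> V" using edge that by auto
      then have "f x < M" using f by (auto simp: PiE_iff)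
      then show "f x \<le> ext a (Suc i)" using s vw[of "Suc i"] that by (auto simp: ext_def a_def)
      show "ext a i \<le> f x" using s vw[of i] that by (auto simp: ext_def a_def)
    qed
    have "a i \<in> win i" if "i \<in> {1..<r}" for i
      using low[of i] high[of "r - i"] vw[OF that] that by (auto simp: a_def win_def)
    then have "a \<in> PiE {1..<r} win" by (auto simp: a_def)
    moreover have "ext a i \<le> ext a (Suc i)" if "i < r" for i
      using ext[OF that, of "w i"] key(1)[OF that] by auto
    ultimately have "a \<in> \<A>" by (simp add: \<A>_def)
    moreover have "f \<in> PiE V (Bx a)"
      using f ext by (auto simp: PiE_iff Bx_def a_def)
    ultimately show "f \<in> (\<Union>a\<in>\<A>. PiE V (Bx a))" by blast
  qed
  then have "card {f \<in> PiE V (\<lambda>_. {..<M}). wide_chain L f xs} \<le> card (\<Union>a\<in>\<A>. PiE V (Bx a))"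
    using fin\<A> finB by (intro card_mono) auto
  also have "\<dots> \<le> (\<Sum>a\<in>\<A>. card (PiE V (Bx a)))" using fin\<A> by (rule card_UN_le)
  finally have "real (card {f \<in> PiE V (\<lambda>_. {..<M}). wide_chain L f xs}) / real M ^ card V
      \<le> (\<Sum>a\<in>\<A>. real (card (PiE V (Bx a)))) / real M ^ card V"
    by (intro divide_right_mono) (simp_all flip: of_nat_sum)
  also have "\<dots> = (\<Sum>a\<in>\<A>. real (card (PiE V (Bx a))) / real M ^ card V)"
    by (simp add: sum_divide_distrib)
  also have "\<dots> \<le> (\<Sum>a\<in>\<A>. (1 / real M) ^ (r - 1) * ?E)"
    using one by (intro sum_mono) auto
  also have "\<dots> = real (card \<A>) * ((1 / real M) ^ (r - 1) * ?E)" by simp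
  also have "\<dots> \<le> real ((M - r * L) ^ (r - 1)) * ((1 / real M) ^ (r - 1) * ?E)"
    using card\<A> by (intro mult_right_mono) (simp_all only: of_nat_le_iff, auto)
  also have "\<dots> = ?W * ?E" by (simp add: power_divide)
  finally show ?thesis .
qed

subsection \<open>The degree bound\<close>

text \<open>Here \<open>p\<close> bounds the probability of a narrow edge and \<open>q\<close> that
  of a wide chain. The support of any event meets at most \<open>r * d\<close> edges and at most
  \<open>r ^ 2 * d ^ r\<close> walks of \<open>r\<close> edges, so \<open>small\<close> is the
  hypothesis of the local lemma.\<close>

lemma low_degree_colorableI:
  fixes n r d L M :: nat
  defines "p \<equiv> real n * (real L / real M) ^ (n - 1)"
  defines "q \<equiv> (real (M - r * L) / real M) ^ (r - 1) * (exp (real r * (real r - 1) / real M) / real r ^ r) ^ (n - 2)"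
  assumes r: "r \<ge> 2" and n: "n > 0" and L: "L > 0" and M: "r * L \<le> M"
    and small: "real (r * d) * p + real (r ^ 2 * d ^ r) * q \<le> 1 / 4"
  shows "low_degree_colorable n r d"
  unfolding low_degree_colorable_def
proof (intro allI impI, elim conjE)
  fix H :: "nat hypergraph"
  assume H: "hypergraph H" "uniform n H" "\<forall>f\<in>snd H. edge_degree H f < d"
  define V E where "V = fst H" and "E = snd H"
  have finV: "finite V" and EV: "\<And>e. e \<in> E \<Longrightarrow> e \<subseteq> V" and cardE: "\<And>e. e \<in> E \<Longrightarrow> card e = n"
    using H by (auto simp: V_def E_def hypergraph_def uniform_def)
  have finE: "finite E" using finV EV by (meson PowI finite_Pow_iff finite_subset subsetI)
  have neE: "e \<noteq> {}" "finite e" if "e \<in> E" for e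
    using cardE[OF that] n finite_subset[OF EV[OF that] finV] by auto
  have "M > 0" using M L r by (metis le_zero_eq mult_is_0 not_gr_zero not_numeral_le_zero)
  have q0: "q \<ge> 0" and p0: "p \<ge> 0" using r by (auto simp: q_def p_def)
  define \<Omega> where "\<Omega> = PiE V (\<lambda>_. {..<M})"
  have fin\<Omega>: "finite \<Omega>" unfolding \<Omega>_def using finV by (intro finite_PiE) auto
  have card\<Omega>: "card \<Omega> = M ^ card V" using finV by (simp add: \<Omega>_def card_PiE)
  have ne\<Omega>: "\<Omega> \<noteq> {}" using \<open>M > 0\<close> by (auto simp: \<Omega>_def PiE_eq_empty_iff)

  define meets where "meets = (\<lambda>a b :: nat set. a \<inter> b \<noteq> {})"
  \<comment> \<open>The strict degree bound leaves room for \<open>y\<close> itself, which meets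
    \<open>y\<close> but is not counted in its degree.\<close>
  have nbrs: "card {e \<in> E. meets y e} \<le> d" if "y \<in> E" for y
  proof -
    have "card {e \<in> E. meets y e} \<le> card (insert y {e \<in> E. e \<noteq> y \<and> e \<inter> y \<noteq> {}})"
      using finE by (intro card_mono) (auto simp: meets_def)
    also have "\<dots> \<le> Suc (edge_degree H y)" unfolding edge_degree_def E_def by (rule card_insert_le_m1) simp_all
    also have "\<dots> \<le> d" using H(3) that by (auto simp: E_def)
    finally show ?thesis .
  qed
  define walks where "walks = {xs. length xs = Suc (r - 1) \<and> set xs \<subseteq> E \<and> successively meets xs}"
  \<comment> \<open>Single edges become lists of length 1, so both kinds of events share an index
    type; \<open>r \<ge> 2\<close> keeps them apart.\<close>
  define I where "I = (\<lambda>e. [e]) ` E \<union> walks"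
  define bad where "bad f xs = (if length xs = 1 then narrow L f (hd xs) else wide_chain L f xs)" for f xs
  define A where "A xs = {f \<in> \<Omega>. bad f xs}" for xs
  define s where "s xs = \<Union>(set xs)" for xs :: "nat set list"
  have finwalks: "finite walks"
    by (rule finite_subset[OF _ finite_lists_length_eq[OF finE, of "Suc (r - 1)"]]) (auto simp: walks_def)
  have len: "length xs \<le> r" "xs \<noteq> []" "set xs \<subseteq> E" if "xs \<in> I" for xs
    using that r by (auto simp: I_def walks_def)

  have "\<exists>f\<in>\<Omega>. \<forall>xs\<in>I. f \<notin> A xs"
    unfolding \<Omega>_def
  proof (rule product_local_lemma[where s = s], fold \<Omega>_def)
    show "finite I" using finE finwalks by (simp add: I_def)
    show "A xs \<subseteq> \<Omega>" for xs by (auto simp: A_def)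
    show "s xs \<noteq> {}" if "xs \<in> I" for xs
      using len[OF that] neE by (cases xs) (auto simp: s_def)
    show "determined_by \<Omega> (A xs) (s xs)" if "xs \<in> I" for xs
      unfolding determined_by_def
    proof (intro ballI impI)
      fix f g assume fg: "f \<in> \<Omega>" "g \<in> \<Omega>" "\<forall>x\<in>s xs. f x = g x" "f \<in> A xs"
      have "narrow L g (hd xs)" if "narrow L f (hd xs)"
      proof -
        have "\<forall>x\<in>hd xs. f x = g x" using fg(3) len[OF \<open>xs \<in> I\<close>] by (cases xs) (auto simp: s_def)
        then show ?thesis using that unfolding narrow_def by (metis (no_types))
      qed
      moreover have "wide_chain L g xs" if "wide_chain L f xs"
      proof -
        have *: "spans g e u w \<and> g u + L \<le> g w" if "e \<in> set xs" "spans f e u w \<and> f u + L \<le> f w" for e u w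
        proof -
          have "\<forall>x\<in>e. f x = g x" using fg(3) that by (auto simp: s_def)
          then show ?thesis using that(2) by (auto simp: spans_def)
        qed
        show ?thesis using that * unfolding wide_chain_def by (meson nth_mem)
      qed
      ultimately show "g \<in> A xs" using fg by (auto simp: A_def bad_def)
    qed
    show "(\<Sum>xs | xs \<in> I \<and> s ys \<inter> s xs \<noteq> {}. real (card (A xs)) / card \<Omega>) \<le> 1 / 4" if "ys \<in> I" for ys
    proof -
      define F where "F = {e \<in> E. meets (s ys) e}"
      have "card F \<le> card (\<Union>y\<in>set ys. {e \<in> E. meets y e})"
        using finE by (intro card_mono) (auto simp: F_def meets_def s_def)
      also have "\<dots> \<le> (\<Sum>y\<in>set ys. card {e \<in> E. meets y e})" by (rule card_UN_le) simp
      also have "\<dots> \<le> (\<Sum>y\<in>set ys. d)" using len(3)[OF that] by (intro sum_mono nbrs) auto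
      also have "\<dots> \<le> r * d" using card_length[of ys] len(1)[OF that] by simp
      finally have cardF: "card F \<le> r * d" .
      have finF: "finite F" using finE by (simp add: F_def)
      define X where "X = (\<lambda>e. [e]) ` F"
      define Y where "Y = {xs \<in> walks. s ys \<inter> s xs \<noteq> {}}"
      have "s [e] = e" for e by (simp add: s_def)
      then have "{xs \<in> I. s ys \<inter> s xs \<noteq> {}} = X \<union> Y"
        unfolding I_def X_def Y_def F_def meets_def by auto
      moreover have "X \<inter> Y = {}" using r by (auto simp: X_def Y_def walks_def)
      moreover have fin: "finite X" "finite Y" using finF finwalks by (auto simp: X_def Y_def)
      ultimately have "(\<Sum>xs | xs \<in> I \<and> s ys \<inter> s xs \<noteq> {}. real (card (A xs)) / card \<Omega>)
          = (\<Sum>xs\<in>X. real (card (A xs)) / card \<Omega>) + (\<Sum>xs\<in>Y. real (card (A xs)) / card \<Omega>)"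
        by (simp add: sum.union_disjoint)
      also have "(\<Sum>xs\<in>X. real (card (A xs)) / card \<Omega>) \<le> (\<Sum>xs\<in>X. p)"
      proof (rule sum_mono)
        fix xs assume "xs \<in> X"
        then obtain e where e: "xs = [e]" "e \<in> E" by (auto simp: X_def F_def)
        then have "A xs = {f \<in> PiE V (\<lambda>_. {..<M}). narrow L f e}" by (simp add: A_def bad_def \<Omega>_def)
        then show "real (card (A xs)) / card \<Omega> \<le> p"
          unfolding card\<Omega> p_def using narrow_probability[OF finV EV cardE n \<open>M > 0\<close>] e by simp
      qed
      also have "(\<Sum>xs\<in>X. p) \<le> real (r * d) * p"
      proof -
        have "card X \<le> r * d" using cardF card_image_le[OF finF, of "\<lambda>e. [e]"] by (simp add: X_def)
        then show ?thesis using p0 by (simp add: mult_right_mono del: of_nat_mult)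
      qed
      also have "(\<Sum>xs\<in>Y. real (card (A xs)) / card \<Omega>) \<le> (\<Sum>xs\<in>Y. q)"
      proof (rule sum_mono)
        fix xs assume "xs \<in> Y"
        then have xs: "length xs = r" "set xs \<subseteq> E" using r by (auto simp: Y_def walks_def)
        then have "A xs = {f \<in> PiE V (\<lambda>_. {..<M}). wide_chain L f xs}"
          using r by (simp add: A_def bad_def \<Omega>_def)
        then show "real (card (A xs)) / card \<Omega> \<le> q"
          using xs r L M \<open>M > 0\<close> finV
          by (simp only: card\<Omega> q_def of_nat_power) (intro wide_chain_probability EV cardE, auto)
      qed
      also have "(\<Sum>xs\<in>Y. q) \<le> real (r ^ 2 * d ^ r) * q"
      proof -
        \<comment> \<open>A walk that meets the support of \<open>ys\<close> does so at one of
          \<open>r\<close> positions; each position allows at most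
          \<open>card F * d ^ (r - 1)\<close> walks.\<close>
        define Z where "Z j = {xs. length xs = Suc (r - 1) \<and> set xs \<subseteq> E \<and> successively meets xs \<and> xs ! j \<in> F}" for j
        have "Y \<subseteq> (\<Union>j<r. Z j)"
        proof
          fix xs assume xs: "xs \<in> Y"
          then obtain e where "e \<in> set xs" "s ys \<inter> e \<noteq> {}" by (auto simp: Y_def s_def)
          then obtain j where j: "j < length xs" "s ys \<inter> xs ! j \<noteq> {}" by (metis in_set_conv_nth)
          have "xs ! j \<in> set xs" using j by simp
          also have "set xs \<subseteq> E" using xs by (simp add: Y_def walks_def)
          finally have "xs ! j \<in> F" using j by (simp add: F_def meets_def)
          then have "xs \<in> Z j" "j < r" using xs j r by (auto simp: Y_def Z_def walks_def)
          then show "xs \<in> (\<Union>j<r. Z j)" by blast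
        qed
        moreover have "finite (Z j)" for j
          by (rule finite_subset[OF _ finwalks]) (auto simp: Z_def walks_def)
        ultimately have "card Y \<le> card (\<Union>j<r. Z j)" by (intro card_mono) auto
        also have "\<dots> \<le> (\<Sum>j<r. card (Z j))" by (rule card_UN_le) simp
        also have "\<dots> \<le> (\<Sum>j<r. card F * d ^ (r - 1))"
          unfolding Z_def using finE nbrs
          by (intro sum_mono card_walks_through) (auto simp: F_def meets_def)
        also have "\<dots> \<le> (\<Sum>j<r. r * d * d ^ (r - 1))"
          using cardF by (intro sum_mono mult_right_mono) auto
        also have "\<dots> = r ^ 2 * d ^ r" using r by (simp add: power2_eq_square power_eq_if)
        finally show ?thesis using q0 by (simp add: mult_right_mono del: of_nat_mult of_nat_power)
      qed
      finally show ?thesis using small by linarith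
    qed
  qed (use fin\<Omega> ne\<Omega> in auto)
  then obtain f where f: "f \<in> \<Omega>" and good: "\<And>xs. xs \<in> I \<Longrightarrow> \<not> bad f xs" by (auto simp: A_def)

  show "colorable r H"
  \<comment> \<open>Pairing weights with names breaks ties. A path of \<open>r\<close> steps would
    consist of edges that are not narrow, hence would be a wide chain, and that is also
    avoided.\<close>
  proof (rule colorable_if_no_long_chain[where h = "\<lambda>v. (f v, v)"], fold E_def)
    let ?R = "{(u, w). \<exists>e\<in>E. u \<in> e \<and> w \<in> e \<and> (\<forall>x\<in>e. (f u, u) \<le> (f x, x) \<and> (f x, x) \<le> (f w, w))}"
    have R: "(u, w) \<in> ?R \<longleftrightarrow> (\<exists>e\<in>E. spans f e u w)" for u w by (auto simp: spans_def)
    show "?R ^^ r = {}"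
    proof (rule ccontr)
      assume "?R ^^ r \<noteq> {}"
      then obtain a b where "(a, b) \<in> ?R ^^ r" by auto
      then obtain v where "\<forall>i<r. (v i, v (Suc i)) \<in> ?R" unfolding relpow_fun_conv by blast
      then have "\<forall>i<r. \<exists>e\<in>E. spans f e (v i) (v (Suc i))" unfolding R .
      then obtain e where e: "\<And>i. i < r \<Longrightarrow> e i \<in> E \<and> spans f (e i) (v i) (v (Suc i))" by metis
      have wide: "f (v i) + L \<le> f (v (Suc i))" if "i < r" for i
      proof (rule ccontr)
        assume less: "\<not> ?thesis"
        have "f (v i) \<le> f x \<and> f x < f (v i) + L" if "x \<in> e i" for x
          using e[OF \<open>i < r\<close>] less that by (fastforce simp: spans_def)
        then have "bad f [e i]" using e[OF that] by (auto simp: bad_def narrow_def spans_def)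
        moreover have "[e i] \<in> I" using e[OF that] by (auto simp: I_def)
        ultimately show False using good by blast
      qed
      define xs where "xs = map e [0..<r]"
      have "meets (e i) (e (Suc i))" if "Suc i < r" for i
        using e[of i] e[of "Suc i"] that by (auto simp: meets_def spans_def)
      then have "xs \<in> walks" using e r by (auto simp: walks_def xs_def successively_conv_nth)
      moreover have "wide_chain L f xs" unfolding wide_chain_def using e wide by (auto simp: xs_def)
      ultimately show False using good[of xs] r by (auto simp: I_def bad_def walks_def)
    qed
  qed (use r neE in auto)
qed

section \<open>Choice of parameters and asymptotics\<close>

lemma real_le_D_plus_1:
  fixes x :: real
  assumes "r \<ge> 1" "\<And>d. real d \<le> x \<Longrightarrow> low_degree_colorable n r d" "x \<ge> 0"
  shows "x \<le> real (D n r) + 1"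
proof -
  have "low_degree_colorable n r (nat \<lfloor>x\<rfloor>)" using assms by (intro assms(2)) simp
  then have "nat \<lfloor>x\<rfloor> \<le> D n r" using assms(1) D_is_maximum(2) by blast
  then show ?thesis using \<open>x \<ge> 0\<close> by linarith
qed

text \<open>The parameters make \<open>r * L / M\<close> equal to \<open>1 - K / (r * n)\<close>,
  with \<open>K / (r * n)\<close> between \<open>4 * l / n\<close> and \<open>5 * l / n\<close>.
  Narrow edges and wide chains each contribute at most 1/8; for the latter, \<open>G ^ r\<close>
  cancels the window factor \<open>(l / n) ^ (r - 1)\<close>.\<close>

lemma low_degree_colorable_asymp:
  fixes n r d :: nat
  defines "G \<equiv> (real n / ln (real n)) powr ((real r - 1) / real r)"
  defines "c \<equiv> 1 / (24 * real r ^ 2 * 5 ^ r * real r ^ (2 * r))"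
  assumes r: "r \<ge> 2" and n: "n \<ge> 2" "ln (real n) \<ge> 1" "5 * ln (real n) < real n"
    and d: "real d \<le> c * (G * real r ^ n)"
  shows "low_degree_colorable n r d"
proof -
  define l where "l = ln (real n)"
  \<comment> \<open>The 4 yields \<open>exp (- 4 * l * (n - 1) / n) \<le> 1 / n ^ 2\<close>: one
    factor \<open>n\<close> pays for the choice of the least vertex, the other for
    \<open>G \<le> n\<close>.\<close>
  define K where "K = nat \<lceil>4 * real r * l\<rceil>"
  \<comment> \<open>A multiple of \<open>r ^ 2 * n\<close> keeps all lengths integral and is large
    enough that the rounding loss in the wide chain bound stays below
    \<open>exp 1 \<le> 3\<close>.\<close>
  define M where "M = r ^ 2 * n"
  define L where "L = r * n - K"
  have l: "l \<ge> 1" "5 * l < real n" using n by (auto simp: l_def)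
  have K_ge: "real K \<ge> 4 * real r * l" unfolding K_def by linarith
  have "real r * l \<ge> 1 * 1" using r l by (intro mult_mono) auto
  moreover have "real K \<le> 4 * real r * l + 1"
  proof -
    have "0 \<le> 4 * real r * l" using l by simp
    then show ?thesis unfolding K_def by linarith
  qed
  ultimately have K_le: "real K \<le> 5 * real r * l" by linarith
  also have "\<dots> < real r * real n" using r l by simp
  finally have "K < r * n" by (simp flip: of_nat_mult)
  then have L: "L > 0" by (simp add: L_def)
  have rL: "r * L \<le> M" "M - r * L = r * K"
    using \<open>K < r * n\<close> by (auto simp: L_def M_def power2_eq_square diff_mult_distrib2)
  have c0: "c > 0" using r by (simp add: c_def)
  \<comment> \<open>The 24 is 8 times this 3; \<open>5 ^ r\<close> and
    \<open>real r ^ (2 * r)\<close> absorb the window bound and the lost vertices at the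
    joints.\<close>
  have c_small: "real r ^ 2 * c \<le> 1 / 8" "3 * real r ^ 2 * 5 ^ r * real r ^ (2 * r) * c = 1 / 8"
  proof -
    define Q where "Q = (5::real) ^ r * real r ^ (2 * r)"
    have "1 * 1 \<le> Q" unfolding Q_def using r by (intro mult_mono one_le_power) auto
    then have Q: "Q \<ge> 1" by simp
    have c: "c = 1 / (24 * real r ^ 2 * Q)" by (simp add: c_def Q_def)
    show "real r ^ 2 * c \<le> 1 / 8" unfolding c using r Q by (simp add: field_simps)
    have "3 * real r ^ 2 * Q * c = 1 / 8" unfolding c using r Q by (simp add: field_simps)
    then show "3 * real r ^ 2 * 5 ^ r * real r ^ (2 * r) * c = 1 / 8" by (simp add: Q_def mult_ac)
  qed
  have c1: "c \<le> 1"
  proof -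
    have "1 * c \<le> real r ^ 2 * c" using r c0 by (intro mult_right_mono) auto
    then show ?thesis using c_small by linarith
  qed
  have base: "real n / l \<ge> 1" "real n / l \<le> real n" using l by (auto simp: field_simps)
  have G0: "G \<ge> 0" by (simp add: G_def)
  have "G \<le> (real n / l) powr 1"
    unfolding G_def l_def[symmetric] using base r by (intro powr_mono) auto
  then have G_le: "G \<le> real n" using base by simp
  have G_pow: "G ^ r = (real n / l) ^ (r - 1)"
  proof -
    have "G ^ r = (real n / l) powr (real r - 1)"
      unfolding G_def l_def[symmetric] using base r by (subst powr_power) auto
    also have "real r - 1 = real (r - 1)" using r by simp
    also have "(real n / l) powr real (r - 1) = (real n / l) ^ (r - 1)"
      using base by (intro powr_realpow) linarith
    finally show ?thesis .
  qed

  have p: "real n * (real L / real M) ^ (n - 1) \<le> real r / (real r ^ n * real n)"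
  proof -
    have "real L / real M = (1 - real K / (real r * real n)) / real r"
      using \<open>K < r * n\<close> r n by (simp add: L_def M_def of_nat_diff field_simps power2_eq_square)
    also have "\<dots> \<le> exp (- (4 * l / real n)) / real r"
    proof (rule divide_right_mono)
      have "4 * l / real n \<le> real K / (real r * real n)"
        using K_ge r n by (simp add: field_simps)
      then show "1 - real K / (real r * real n) \<le> exp (- (4 * l / real n))"
        using exp_ge_add_one_self[of "- (4 * l / real n)"] by linarith
    qed simp
    finally have "(real L / real M) ^ (n - 1) \<le> (exp (- (4 * l / real n)) / real r) ^ (n - 1)"
      by (intro power_mono) auto
    also have "\<dots> = exp (- (4 * l / real n) * real (n - 1)) / real r ^ (n - 1)"
      by (simp add: power_divide exp_of_nat_mult[symmetric] mult.commute)
    also have "\<dots> \<le> exp (- 2 * l) / real r ^ (n - 1)"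
    proof (intro divide_right_mono)
      have "2 * l * real n \<le> 4 * l * real (n - 1)" using n l by (simp add: of_nat_diff)
      then show "exp (- (4 * l / real n) * real (n - 1)) \<le> exp (- 2 * l)" using n by (simp add: field_simps)
    qed simp
    also have "exp (- 2 * l) = 1 / real n ^ 2"
    proof -
      have "exp (- 2 * l) = inverse (exp l ^ 2)"
        by (simp add: exp_minus exp_of_nat_mult[symmetric])
      then show ?thesis using n by (simp add: l_def field_simps)
    qed
    finally have "real n * (real L / real M) ^ (n - 1) \<le> real n * (1 / real n ^ 2 / real r ^ (n - 1))"
      by (intro mult_left_mono) auto
    also have "\<dots> = real r / (real r ^ n * real n)"
      using n r by (simp add: field_simps power2_eq_square power_eq_if)
    finally show ?thesis .
  qed
  have "real (r * d) * (real n * (real L / real M) ^ (n - 1))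
      \<le> (real r * (c * (real n * real r ^ n))) * (real r / (real r ^ n * real n))"
    using p G_le c0 d by (intro mult_mono) (auto intro!: mult_left_mono order_trans[OF d] mult_right_mono)
  also have "\<dots> = real r ^ 2 * c" using r n by (simp add: field_simps power2_eq_square)
  finally have first: "real (r * d) * (real n * (real L / real M) ^ (n - 1)) \<le> 1 / 8"
    using c_small by linarith

  have W: "(real (M - r * L) / real M) ^ (r - 1) \<le> (5 * l / real n) ^ (r - 1)"
  proof (rule power_mono)
    have "real (M - r * L) / real M = real K / (real r * real n)"
      unfolding rL(2) using r n by (simp add: M_def power2_eq_square)
    also have "\<dots> \<le> 5 * l / real n" using K_le r n by (simp add: field_simps)
    finally show "real (M - r * L) / real M \<le> 5 * l / real n" .
  qed simp
  have E: "(exp (real r * (real r - 1) / real M) / real r ^ r) ^ (n - 2) \<le> 3 * real r ^ (2 * r) / real r ^ (r * n)"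
  proof -
    have "real r * (real r - 1) \<le> real r ^ 2" using r by (simp add: power2_eq_square)
    then have "real r * (real r - 1) / real M * real (n - 2) \<le> real r ^ 2 / real M * real n"
      by (intro mult_mono divide_right_mono) auto
    also have "\<dots> = 1" using r n by (simp add: M_def)
    finally have "exp (real r * (real r - 1) / real M * real (n - 2)) \<le> exp 1" by simp
    also have "\<dots> \<le> (3::real)" by (rule exp_le)
    finally have "exp (real r * (real r - 1) / real M) ^ (n - 2) \<le> 3"
      by (simp add: exp_of_nat_mult[symmetric] mult.commute)
    then have "(exp (real r * (real r - 1) / real M) / real r ^ r) ^ (n - 2) \<le> 3 / real r ^ (r * (n - 2))"
      by (simp add: power_divide power_mult divide_right_mono)
    also have "\<dots> = 3 * real r ^ (2 * r) / real r ^ (r * n)"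
    proof -
      have "r * n = r * (n - 2) + 2 * r" using n by (simp add: diff_mult_distrib2)
      then have "real r ^ (r * n) = real r ^ (r * (n - 2)) * real r ^ (2 * r)" by (simp only: power_add)
      then show ?thesis using r by simp
    qed
    finally show ?thesis .
  qed
  have "real (r ^ 2 * d ^ r) * ((real (M - r * L) / real M) ^ (r - 1)
        * (exp (real r * (real r - 1) / real M) / real r ^ r) ^ (n - 2))
      \<le> (real r ^ 2 * (c * (G * real r ^ n)) ^ r) * ((5 * l / real n) ^ (r - 1) * (3 * real r ^ (2 * r) / real r ^ (r * n)))"
  proof (intro mult_mono W E)
    show "real (r ^ 2 * d ^ r) \<le> real r ^ 2 * (c * (G * real r ^ n)) ^ r"
      using d by (simp add: mult_left_mono power_mono)
  qed (use c0 G0 l in auto)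
  also have "\<dots> = 3 * real r ^ 2 * real r ^ (2 * r) * c ^ r * (5 ^ (r - 1) * ((real n / l) ^ (r - 1) * (l / real n) ^ (r - 1)))"
    using r by (simp add: power_mult_distrib G_pow power_mult[symmetric] mult.commute[of n r] power_divide)
  also have "(real n / l) ^ (r - 1) * (l / real n) ^ (r - 1) = 1"
    using l n by (simp flip: power_mult_distrib)
  \<comment> \<open>As \<open>c \<le> 1\<close>, the power \<open>c ^ r\<close> is at most
    \<open>c\<close>.\<close>
  also have "3 * real r ^ 2 * real r ^ (2 * r) * c ^ r * (5 ^ (r - 1) * 1)
      \<le> 3 * real r ^ 2 * real r ^ (2 * r) * c * (5 ^ r * 1)"
    using r c0 c1 power_decreasing[of 1 r c]
    by (intro mult_mono) (auto intro!: power_increasing)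
  also have "\<dots> = 1 / 8" using c_small by (simp add: mult_ac)
  finally have second: "real (r ^ 2 * d ^ r) * ((real (M - r * L) / real M) ^ (r - 1)
        * (exp (real r * (real r - 1) / real M) / real r ^ r) ^ (n - 2)) \<le> 1 / 8" .
  show ?thesis
    using r n L rL first second by (intro low_degree_colorableI[where L = L and M = M]) auto
qed

theorem theorem3:
  fixes r :: nat
  assumes "r \<ge> 2"
  shows "(\<lambda>n. real (D n r)) \<in> \<Omega>(\<lambda>n. (real n / ln (real n)) powr ((real r - 1) / real r) * real r ^ n)"
proof -
  define g where "g n = (real n / ln (real n)) powr ((real r - 1) / real r) * real r ^ n" for n
  define c where "c = 1 / (24 * real r ^ 2 * 5 ^ r * real r ^ (2 * r))"
  have c0: "c > 0" using assms by (simp add: c_def)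
  \<comment> \<open>This makes \<open>c * g n\<close> at least 2, so halving the constant absorbs
    the loss of 1 from rounding to an integer degree.\<close>
  have "eventually (\<lambda>n. 2 / c \<le> real r ^ n) sequentially"
  proof -
    have "filterlim (\<lambda>n. norm (real r ^ n)) at_top sequentially"
      using assms by (intro filterlim_at_infinity_imp_norm_at_top filterlim_realpow_sequentially_gt1) auto
    then show ?thesis by (simp add: filterlim_at_top)
  qed
  moreover have "eventually (\<lambda>n. ln (real n) / real n < 1 / 5) sequentially"
    by (rule order_tendstoD(2)[OF filterlim_compose[OF ln_x_over_x_tendsto_0 filterlim_real_sequentially]]) simp
  \<comment> \<open>From 3 on, \<open>n\<close> exceeds \<open>exp 1\<close>, so \<open>ln n\<close>
    is at least 1.\<close>
  moreover have "eventually (\<lambda>n::nat. n \<ge> 3) sequentially" by (rule eventually_ge_at_top)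
  ultimately have "eventually (\<lambda>n. norm (real (D n r)) \<ge> (c / 2) * norm (g n)) sequentially"
  proof eventually_elim
    case (elim n)
    then have n: "n \<ge> 2" "5 * ln (real n) < real n" by (auto simp: field_simps)
    have "exp 1 \<le> real n" using elim exp_le by linarith
    then have ln: "ln (real n) \<ge> 1" using n by (simp add: ln_ge_iff)
    have "real n / ln (real n) \<ge> 1" using n ln by (simp add: field_simps)
    then have "(real n / ln (real n)) powr ((real r - 1) / real r) \<ge> 1"
      using assms by (intro ge_one_powr_ge_zero) auto
    then have "1 * real r ^ n \<le> g n" unfolding g_def by (intro mult_right_mono) auto
    then have g: "2 / c \<le> g n" "g n \<ge> 0" using elim by (auto simp: g_def)
    then have "2 \<le> c * g n" using c0 by (simp add: field_simps)
    moreover have "c * g n \<le> real (D n r) + 1"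
      using assms g c0 n ln unfolding c_def g_def
      by (intro real_le_D_plus_1 low_degree_colorable_asymp) auto
    ultimately show ?case using g by simp
  qed
  then show ?thesis using c0 by (intro landau_omega.bigI[of "c / 2"]) (auto simp: g_def)
qed

end
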